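(* For every integer $n\geq 3$, $c_3(n)=c_4(n)$, where $c_3(n)=|\mathcal C_n^{+-+}|$ and $c_4(n)=|\mathcal C_n^{-+-}|$; that is, the signatures $+-+$ and $-+-$ are c-Wilf-equivalent.
   Context: $\mathcal S_n$ is the set of permutations of $[n]$ in one-line notation $\pi=\pi_1\cdots\pi_n$; $\mathcal C_n$ is the set of cyclic permutations (single $n$-cycle) in $\mathcal S_n$. For $\sigma=\sigma^0\cdots\sigma^{k-1}\in\{+,-\}^k$, $\mathcal S^\sigma_n$ is the set of $\pi\in\mathcal S_n$ for which there exist $0=e_0\le e_1\le\cdots\le e_k=n$ with each segment $\pi_{e_i+1}\cdots\pi_{e_{i+1}}$ increasing if $\sigma^i=+$ and decreasing if $\sigma^i=-$; $\mathcal C_n^\sigma=\mathcal C_n\cap\mathcal S_n^\sigma$. Two signatures are c-Wilf-equivalent if for every $n$ they have equally many cyclic permutations of length $n$ in their classes. *)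

theory Defs
  imports Main
begin

definition perm_of :: "nat \<Rightarrow> (nat \<Rightarrow> nat) \<Rightarrow> bool" where
  "perm_of n p \<longleftrightarrow> bij_betw p {1..n} {1..n} \<and> (\<forall>i. i \<notin> {1..n} \<longrightarrow> p i = i)"

definition cyclic_perm :: "nat \<Rightarrow> (nat \<Rightarrow> nat) \<Rightarrow> bool" where
  "cyclic_perm n p \<longleftrightarrow> perm_of n p \<and>
     (\<forall>i\<in>{1..n}. \<forall>j\<in>{1..n}. \<exists>k. (p ^^ k) i = j)"

(* signatures: True = '+', False = '-' *)
definition in_sig_class :: "bool list \<Rightarrow> nat \<Rightarrow> (nat \<Rightarrow> nat) \<Rightarrow> bool" where
  "in_sig_class \<sigma> n p \<longleftrightarrow> perm_of n p \<and>
     (\<exists>e :: nat \<Rightarrow> nat. e 0 = 0 \<and> e (length \<sigma>) = n \<and>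
        (\<forall>i < length \<sigma>. e i \<le> e (Suc i)) \<and>
        (\<forall>i < length \<sigma>. \<forall>a b. e i + 1 \<le> a \<and> a < b \<and> b \<le> e (Suc i) \<longrightarrow>
            (if \<sigma> ! i then p a < p b else p a > p b)))"

definition cyc_class :: "bool list \<Rightarrow> nat \<Rightarrow> (nat \<Rightarrow> nat) set" where
  "cyc_class \<sigma> n = {p. cyclic_perm n p \<and> in_sig_class \<sigma> n p}"

end

theory Submission
  imports Defs Complex_Main "HOL-Library.FuncSet"
begin

text \<open>
  Both signatures have the form \<open>t, \<not> t, t\<close>. A cyclic permutation in either class, of length at
  least 3, has exactly four segmentations, because each of its two turning points may be attached
  to either neighbouring segment. Recording the segment visited at each step of the cycle turns a
  permutation with a segmentation and a base point into a periodic word over three letters.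
  Conversely, the cyclic order of the points is the lexicographic order of the shifts of the word,
  reversed at every letter of negative sign. A primitive word therefore comes from exactly one
  triple; the square of a primitive word with an odd number of negative letters comes from two,
  which differ in how the two equal shifts are ordered; any other word comes from none.

  It remains to see that primitive words of length \<open>d > 1\<close> with sign product \<open>-1\<close> are equally many for
  both signatures. Exchanging the signatures multiplies the sign product by \<open>(-1)^d\<close>, so only odd
  \<open>d\<close> matters. The signs of all words of length \<open>d\<close> sum to \<open>(1 - 1 + 1)^d = 1\<close>; splitting
  this sum over primitive roots shows that the signs of the primitive words sum to 0 if \<open>d > 1\<close>.
\<close>

subsection \<open>Words and their signs\<close>

text \<open>\<open>t\<close> is the common sign of the two outer segments (\<open>True\<close> for
  +) and letter 1 stands for the middle segment, so one formula covers both signatures.\<close>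

definition letter_sign :: "bool \<Rightarrow> nat \<Rightarrow> int" where
  "letter_sign t c = (if (c = 1) = t then -1 else 1)"

text \<open>Words are \<open>n\<close>-periodic sequences of segment indices.\<close>

definition words :: "nat \<Rightarrow> (nat \<Rightarrow> nat) set" where
  "words n = {w. (\<forall>j. w (j + n) = w j) \<and> (\<forall>j. w j < 3)}"

text \<open>For length 0 the periodicity condition in \<open>words\<close> is vacuous; hence the
  positivity assumptions on lengths below.\<close>

definition primitive_words :: "nat \<Rightarrow> (nat \<Rightarrow> nat) set" where
  "primitive_words n = {w \<in> words n. \<forall>d. 0 < d \<and> d < n \<longrightarrow> w \<notin> words d}"

lemma letter_sign_cases: "letter_sign t c = 1 \<or> letter_sign t c = -1"
  by (simp add: letter_sign_def)

lemma letter_sign_nonzero [simp]: "letter_sign t c \<noteq> 0"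
  by (simp add: letter_sign_def)

lemma letter_sign_square [simp]: "letter_sign t c * letter_sign t c = 1"
  by (simp add: letter_sign_def)

lemma prod_letter_sign_cases:
  fixes d :: nat
  shows "(\<Prod>i<d. letter_sign t (w i)) = 1 \<or> (\<Prod>i<d. letter_sign t (w i)) = -1"
proof (induction d)
  case (Suc d)
  then show ?case using letter_sign_cases[of t "w d"] by auto
qed simp

section \<open>Periods and the primitive period of a word\<close>

lemma periodic_add_mult:
  assumes "\<And>j. f (j + d) = f j"
  shows "f (j + d * q) = f (j :: nat)"
proof (induction q)
  case (Suc q)
  then show ?case using assms[of "j + d * q"] by (simp add: algebra_simps)
qed simp

lemma periodic_mod:
  assumes "\<And>j. f (j + d) = f j"
  shows "f (j mod d) = f (j :: nat)"
  using periodic_add_mult[of f d "j mod d" "j div d", OF assms] by simp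

lemma words_add_mult: "w \<in> words d \<Longrightarrow> w (j + d * q) = w j"
  by (rule periodic_add_mult) (simp add: words_def)

lemma words_mod: "w \<in> words d \<Longrightarrow> w (j mod d) = w j"
  by (rule periodic_mod) (simp add: words_def)

lemma words_mult: "w \<in> words d \<Longrightarrow> w \<in> words (d * q)"
  using words_add_mult by (simp add: words_def)

lemma words_diff: "w \<in> words a \<Longrightarrow> w \<in> words (a + b) \<Longrightarrow> w \<in> words b"
  by (simp add: words_def) (metis add.assoc add.commute)

text \<open>A Euclidean step: multiples and differences of periods are periods. It makes the least
  positive period divide every period.\<close>

lemma words_mod_period: "w \<in> words a \<Longrightarrow> w \<in> words b \<Longrightarrow> w \<in> words (a mod b)"
  using words_diff[of w "b * (a div b)" "a mod b"] words_mult[of w b "a div b"] by simp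

lemma primitive_words_dvd:
  assumes "w \<in> primitive_words d" "w \<in> words n" "0 < d"
  shows "d dvd n"
proof -
  have "w \<in> words (n mod d)"
    using assms words_mod_period by (simp add: primitive_words_def)
  moreover have "n mod d < d" using assms by simp
  ultimately have "n mod d = 0"
    using assms by (auto simp: primitive_words_def)
  then show ?thesis by auto
qed

lemma primitive_words_unique:
  assumes "w \<in> primitive_words d" "w \<in> primitive_words e" "0 < d" "0 < e"
  shows "d = e"
  using assms unfolding primitive_words_def by (cases d e rule: linorder_cases) auto

lemma primitive_period_exists:
  assumes "w \<in> words n" "0 < n"
  shows "\<exists>d. 0 < d \<and> d \<le> n \<and> w \<in> primitive_words d"
proof -
  define d where "d = (LEAST d. 0 < d \<and> w \<in> words d)"
  have "0 < d \<and> w \<in> words d"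
    unfolding d_def by (rule LeastI[where k = n]) (use assms in simp)
  moreover have "\<not> (0 < e \<and> w \<in> words e)" if "e < d" for e
    using that unfolding d_def by (rule not_less_Least)
  moreover have "d \<le> n" unfolding d_def by (rule Least_le) (use assms in simp)
  ultimately show ?thesis by (auto simp: primitive_words_def)
qed

section \<open>Signed counts of words and of primitive words\<close>

lemma bij_betw_words:
  assumes "0 < d"
  shows "bij_betw (\<lambda>g j. g (j mod d)) (PiE {..<d} (\<lambda>_. {..<3})) (words d)"
proof (rule bij_betw_byWitness[where f' = "\<lambda>w. restrict w {..<d}"])
  show "\<forall>g\<in>PiE {..<d} (\<lambda>_. {..<3::nat}). restrict (\<lambda>j. g (j mod d)) {..<d} = g"
  proof
    fix g assume "g \<in> PiE {..<d} (\<lambda>_. {..<3::nat})"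
    then show "restrict (\<lambda>j. g (j mod d)) {..<d} = g"
      by (auto simp: fun_eq_iff PiE_def extensional_def)
  qed
  show "\<forall>w\<in>words d. (\<lambda>j. restrict w {..<d} (j mod d)) = w"
    using assms words_mod by auto
  show "(\<lambda>g j. g (j mod d)) ` PiE {..<d} (\<lambda>_. {..<3}) \<subseteq> words d"
    using assms by (auto simp: words_def PiE_def Pi_def)
  show "(\<lambda>w. restrict w {..<d}) ` words d \<subseteq> PiE {..<d} (\<lambda>_. {..<3})"
    by (rule image_subsetI, rule restrict_PiE_iff[THEN iffD2]) (simp add: words_def)
qed

lemma finite_words: "0 < d \<Longrightarrow> finite (words d)"
  using bij_betw_finite[OF bij_betw_words] by (simp add: finite_PiE)

lemma finite_primitive_words: "0 < d \<Longrightarrow> finite (primitive_words d)"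
  by (simp add: primitive_words_def finite_words)

text \<open>The \<open>d\<close> letters are chosen freely, so by distributivity the sum factors
  into \<open>d\<close> copies of 1 - 1 + 1.\<close>

lemma sum_words_sign:
  assumes "0 < d"
  shows "(\<Sum>w\<in>words d. \<Prod>i<d. letter_sign True (w i)) = 1"
proof -
  have "(\<Sum>w\<in>words d. \<Prod>i<d. letter_sign True (w i))
      = (\<Sum>g\<in>PiE {..<d} (\<lambda>_. {..<3}). \<Prod>i<d. letter_sign True (g (i mod d)))"
    by (rule sum.reindex_bij_betw[OF bij_betw_words[OF assms], symmetric])
  also have "\<dots> = (\<Sum>g\<in>PiE {..<d} (\<lambda>_. {..<3}). \<Prod>i\<in>{..<d}. letter_sign True (g i))"
    by (intro sum.cong prod.cong) auto
  also have "\<dots> = (\<Prod>i<d. \<Sum>c<3. letter_sign True c)"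
    by (subst prod_sum_PiE) auto
  also have "\<dots> = 1" by (simp add: letter_sign_def numeral_3_eq_3)
  finally show ?thesis .
qed

lemma prod_lessThan_add:
  fixes h :: "nat \<Rightarrow> int"
  shows "(\<Prod>i<a + b. h i) = (\<Prod>i<a. h i) * (\<Prod>i<b. h (a + i))"
  by (induction b) (simp_all add: mult.assoc)

lemma prod_words_mult:
  fixes h :: "nat \<Rightarrow> int"
  assumes "w \<in> words d"
  shows "(\<Prod>i<d * q. h (w i)) = (\<Prod>i<d. h (w i)) ^ q"
proof (induction q)
  case (Suc q)
  have "(\<Prod>i<d * q + d. h (w i)) = (\<Prod>i<d. h (w i)) ^ q * (\<Prod>i<d. h (w (i + d * q)))"
    unfolding prod_lessThan_add Suc by (simp add: add.commute)
  also have "(\<Prod>i<d. h (w (i + d * q))) = (\<Prod>i<d. h (w i))"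
    using words_add_mult[OF assms] by simp
  finally show ?case by (simp add: add.commute mult.commute)
qed simp

lemma words_eq_UN_primitive:
  assumes "0 < n"
  shows "words n = (\<Union>d\<in>{d. d dvd n}. primitive_words d)"
proof
  show "words n \<subseteq> (\<Union>d\<in>{d. d dvd n}. primitive_words d)"
    using primitive_period_exists[OF _ assms] primitive_words_dvd by blast
  show "(\<Union>d\<in>{d. d dvd n}. primitive_words d) \<subseteq> words n"
    using words_mult by (auto simp: primitive_words_def elim!: dvdE)
qed

text \<open>In odd length \<open>n\<close>, a word of primitive period \<open>m\<close> is an odd
  power of its root and has the same sign, so the sums \<open>Q m\<close> over all divisors
  \<open>m\<close> of \<open>n\<close> add up to 1. As \<open>Q 1 = 1\<close> accounts for the whole
  total, strong induction makes the other \<open>Q d\<close> vanish.\<close>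

lemma sum_primitive_words_sign:
  assumes "odd d" "1 < d"
  shows "(\<Sum>w\<in>primitive_words d. \<Prod>i<d. letter_sign True (w i)) = 0"
proof -
  define Q where "Q d = (\<Sum>w\<in>primitive_words d. \<Prod>i<d. letter_sign True (w i))" for d
  have decomp: "(\<Sum>m | m dvd n. Q m) = 1" if "odd n" for n
  proof -
    have n: "0 < n" using that by (rule odd_pos)
    have fin: "finite {m. m dvd n}" using n by (simp add: finite_divisors_nat)
    have pos: "0 < m" if "m dvd n" for m using that n by (auto intro: Nat.gr0I)
    have "1 = (\<Sum>w\<in>words n. \<Prod>i<n. letter_sign True (w i))"
      using sum_words_sign[OF n] by simp
    also have "\<dots> = (\<Sum>m | m dvd n. \<Sum>w\<in>primitive_words m. \<Prod>i<n. letter_sign True (w i))"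
      unfolding words_eq_UN_primitive[OF n]
      using fin pos primitive_words_unique finite_primitive_words
      by (intro sum.UNION_disjoint) auto
    also have "\<dots> = (\<Sum>m | m dvd n. Q m)"
    proof (rule sum.cong[OF refl])
      fix m assume "m \<in> {m. m dvd n}"
      then obtain q where q: "n = m * q" by auto
      with \<open>odd n\<close> have "odd q" by simp
      show "(\<Sum>w\<in>primitive_words m. \<Prod>i<n. letter_sign True (w i)) = Q m"
        unfolding Q_def
      proof (rule sum.cong[OF refl])
        fix w assume "w \<in> primitive_words m"
        then have "w \<in> words m" by (simp add: primitive_words_def)
        then have "(\<Prod>i<n. letter_sign True (w i)) = (\<Prod>i<m. letter_sign True (w i)) ^ q"
          unfolding q by (rule prod_words_mult)
        also have "\<dots> = (\<Prod>i<m. letter_sign True (w i))"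
          using prod_letter_sign_cases[of True w m] \<open>odd q\<close> by auto
        finally show "(\<Prod>i<n. letter_sign True (w i)) = (\<Prod>i<m. letter_sign True (w i))" .
      qed
    qed
    finally show ?thesis by simp
  qed
  have Q1: "Q 1 = 1" using decomp[of 1] by simp
  have "odd d \<Longrightarrow> 1 < d \<Longrightarrow> Q d = 0"
  proof (induction d rule: less_induct)
    case (less d)
    have fin: "finite {m. m dvd d}" using less.prems by (simp add: finite_divisors_nat)
    \<comment> \<open>The divisors strictly between 1 and \<open>d\<close> are odd and contribute 0
      by induction.\<close>
    have "1 = (\<Sum>m\<in>{1, d}. Q m)"
      unfolding decomp[OF less.prems(1), symmetric]
    proof (rule sum.mono_neutral_right)
      show "\<forall>m\<in>{m. m dvd d} - {1, d}. Q m = 0"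
      proof
        fix m assume m: "m \<in> {m. m dvd d} - {1, d}"
        then have "m dvd d" "m \<noteq> 1" "m \<noteq> d" by auto
        then have "m < d" "odd m" "m \<noteq> 0"
          using less.prems by (auto dest: dvd_imp_le simp: le_less)
        then show "Q m = 0" using less.IH[of m] \<open>m \<noteq> 1\<close> by simp
      qed
    qed (use fin in auto)
    then show ?case using less.prems Q1 by simp
  qed
  with assms show ?thesis by (simp add: Q_def)
qed

text \<open>Exchanging the signatures negates every letter sign. For even \<open>d\<close> the two
  sets coincide; for odd \<open>d\<close> the second one consists of the words of sign 1 with
  respect to \<open>True\<close>, and these match the words of sign -1 because the signed sum is
  0.\<close>

lemma card_negative_primitive_words:
  assumes "1 < d"
  shows "card {w \<in> primitive_words d. (\<Prod>i<d. letter_sign True (w i)) = -1}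
       = card {w \<in> primitive_words d. (\<Prod>i<d. letter_sign False (w i)) = -1}"
proof -
  have flip: "(\<Prod>i<d. letter_sign False (w i)) = (-1) ^ d * (\<Prod>i<d. letter_sign True (w i))" for w
    by (induction d) (auto simp: letter_sign_def)
  show ?thesis
  proof (cases "even d")
    case True
    then show ?thesis by (simp add: flip)
  next
    case False
    let ?s = "\<lambda>w. \<Prod>i<d. letter_sign True (w i)"
    let ?N = "{w \<in> primitive_words d. ?s w = -1}" and ?P = "{w \<in> primitive_words d. ?s w = 1}"
    have fin: "finite ?N" "finite ?P" using finite_primitive_words assms by auto
    have "primitive_words d = ?N \<union> ?P" using prod_letter_sign_cases by blast
    then have "(\<Sum>w\<in>primitive_words d. ?s w) = (\<Sum>w\<in>?N \<union> ?P. ?s w)" by simp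
    also have "\<dots> = (\<Sum>w\<in>?N. ?s w) + (\<Sum>w\<in>?P. ?s w)"
      using fin by (intro sum.union_disjoint) auto
    also have "\<dots> = int (card ?P) - int (card ?N)" by simp
    finally have "card ?P = card ?N" using sum_primitive_words_sign False assms by simp
    then show ?thesis using False by (simp add: flip)
  qed
qed

subsection \<open>Orders compatible with a word\<close>

text \<open>For \<open>w\<close> the sequence of segment indices met along the cycle from some base point, a member
  \<open>f\<close> is the sequence of points itself.\<close>

definition orders :: "bool \<Rightarrow> nat \<Rightarrow> (nat \<Rightarrow> nat) \<Rightarrow> (nat \<Rightarrow> nat) set" where
  "orders t n w = {f. (\<forall>j. f (j + n) = f j) \<and> bij_betw f {..<n} {1..n} \<and>
     (\<forall>j k. w j < w k \<longrightarrow> f j < f k) \<and>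
     (\<forall>j k. w j = w k \<longrightarrow> sgn (int (f k) - int (f j))
        = letter_sign t (w j) * sgn (int (f (Suc k)) - int (f (Suc j))))}"

lemma orders_periodic: "f \<in> orders t n w \<Longrightarrow> f (j + n) = f j"
  by (simp add: orders_def)

lemma orders_mod: "f \<in> orders t n w \<Longrightarrow> f (j mod n) = f j"
  by (rule periodic_mod) (simp add: orders_def)

lemma orders_eq_iff:
  assumes "f \<in> orders t n w" "0 < n"
  shows "f j = f k \<longleftrightarrow> j mod n = k mod n"
proof -
  have "inj_on f {..<n}" using assms by (simp add: orders_def bij_betw_def)
  then have "f (j mod n) = f (k mod n) \<longleftrightarrow> j mod n = k mod n"
    using assms by (intro inj_on_eq_iff) auto
  then show ?thesis using orders_mod[OF assms(1)] by simp
qed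

lemma orders_letter_less: "f \<in> orders t n w \<Longrightarrow> w j < w k \<Longrightarrow> f j < f k"
  by (simp add: orders_def)

text \<open>Iterating the last clause of \<open>orders\<close> postpones a comparison by
  \<open>m\<close> steps at the cost of the sign of the common prefix.\<close>

lemma orders_common_prefix:
  assumes f: "f \<in> orders t n w" and eq: "\<And>r. r < m \<Longrightarrow> w (j + r) = w (k + r)"
  shows "sgn (int (f k) - int (f j))
       = (\<Prod>r<m. letter_sign t (w (j + r))) * sgn (int (f (k + m)) - int (f (j + m)))"
  using eq
proof (induction m)
  case (Suc m)
  have "sgn (int (f (k + m)) - int (f (j + m)))
      = letter_sign t (w (j + m)) * sgn (int (f (Suc (k + m))) - int (f (Suc (j + m))))"
    using f Suc.prems[of m] by (simp add: orders_def)
  then show ?case using Suc by (simp add: mult.assoc)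
qed simp

section \<open>Uniqueness and non-existence of compatible orders\<close>

lemma sgn_diff_swap: "sgn (a - b) = - sgn (b - a)" for a b :: int
  by (simp add: sgn_if)

text \<open>The values fill \<open>{1..n}\<close>, so each is the rank of its position, and the
  comparisons of the first \<open>n\<close> positions determine everything.\<close>

lemma orders_eqI:
  assumes "f \<in> orders t n w" "g \<in> orders t n w" "0 < n"
    and eq: "\<And>j k. j < k \<Longrightarrow> k < n \<Longrightarrow> sgn (int (f k) - int (f j)) = sgn (int (g k) - int (g j))"
  shows "f = g"
proof -
  have eq': "sgn (int (f k) - int (f j)) = sgn (int (g k) - int (g j))" if "j < n" "k < n" for j k
  proof (cases j k rule: linorder_cases)
    case greater
    have "sgn (int (f j) - int (f k)) = sgn (int (g j) - int (g k))" using eq greater that by simp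
    then show ?thesis
      by (simp add: sgn_diff_swap[of "int (f k)"] sgn_diff_swap[of "int (g k)"])
  qed (use eq that in auto)
  have rank: "h j = card {k \<in> {..<n}. h k \<le> h j}" if h: "h \<in> orders t n w" and "j < n" for h j
  proof -
    have bij: "bij_betw h {..<n} {1..n}" using h by (simp add: orders_def)
    then have "h j \<in> {1..n}" using \<open>j < n\<close> by (auto dest: bij_betwE)
    have "h ` {k \<in> {..<n}. h k \<le> h j} = {x \<in> h ` {..<n}. x \<le> h j}" by auto
    also have "\<dots> = {1..h j}"
      using bij \<open>h j \<in> {1..n}\<close> by (auto simp: bij_betw_def)
    finally have "card (h ` {k \<in> {..<n}. h k \<le> h j}) = h j" by simp
    moreover have "inj_on h {k \<in> {..<n}. h k \<le> h j}"
      using bij by (auto simp: bij_betw_def inj_on_def)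
    ultimately show ?thesis by (simp add: card_image)
  qed
  have "f j = g j" if "j < n" for j
  proof -
    have "f k \<le> f j \<longleftrightarrow> g k \<le> g j" if "k < n" for k
      using eq'[of k j] \<open>j < n\<close> that by (auto simp: sgn_if split: if_splits)
    then have "{k \<in> {..<n}. f k \<le> f j} = {k \<in> {..<n}. g k \<le> g j}" by auto
    then show ?thesis using rank[OF assms(1) that] rank[OF assms(2) that] by simp
  qed
  then have "f (j mod n) = g (j mod n)" for j using assms by simp
  then show ?thesis using orders_mod[OF assms(1)] orders_mod[OF assms(2)] by auto
qed

text \<open>Shifting by \<open>d\<close> preserves the comparison of \<open>f 0\<close> with
  \<open>f d\<close>, so the values at 0, \<open>d\<close>, \<open>2 * d\<close>, ... are strictly
  monotone or constant. After \<open>n\<close> shifts the value \<open>f 0\<close> recurs, so they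
  are constant, and injectivity on one period gives the divisibility.\<close>

lemma orders_positive_period:
  assumes f: "f \<in> orders t n w" and w: "w \<in> words d" and n: "0 < n"
    and pos: "(\<Prod>i<d. letter_sign t (w i)) = 1"
  shows "n dvd d"
proof -
  let ?c = "sgn (int (f d) - int (f 0))"
  have step: "?c = sgn (int (f (d * Suc q)) - int (f (d * q)))" for q
  proof (induction q)
    case (Suc q)
    have "w (d * q + r) = w (d * Suc q + r)" for r
      using words_add_mult[OF w, of r] by (metis add.commute)
    then have "sgn (int (f (d * Suc q)) - int (f (d * q)))
       = (\<Prod>r<d. letter_sign t (w (d * q + r)))
         * sgn (int (f (d * Suc q + d)) - int (f (d * q + d)))"
      by (intro orders_common_prefix[OF f])
    also have "(\<Prod>r<d. letter_sign t (w (d * q + r))) = 1"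
      using pos words_add_mult[OF w] by (simp add: add.commute)
    finally show ?case using Suc by (simp add: add.commute)
  qed simp
  have wrap: "f (d * n) = f 0"
    using periodic_add_mult[of f n 0 d, OF orders_periodic[OF f]] by (simp add: mult.commute)
  consider "?c = 1" | "?c = -1" | "?c = 0" by (metis sgn_if)
  then show ?thesis
  proof cases
    case 1
    have "int (f (d * q)) \<ge> int (f 0) + int q" for q
    proof (induction q)
      case (Suc q)
      have "int (f (d * Suc q)) > int (f (d * q))"
        using step[of q] 1 by (simp add: sgn_if split: if_splits)
      then show ?case using Suc by simp
    qed simp
    from this[of n] show ?thesis using wrap n by simp
  next
    case 2
    have "int (f (d * q)) \<le> int (f 0) - int q" for q
    proof (induction q)
      case (Suc q)
      have "int (f (d * Suc q)) < int (f (d * q))"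
        using step[of q] 2 by (simp add: sgn_if split: if_splits)
      then show ?case using Suc by simp
    qed simp
    from this[of n] show ?thesis using wrap n by simp
  next
    case 3
    then have "f d = f 0" by (simp add: sgn_if split: if_splits)
    then show ?thesis using orders_eq_iff[OF f n] by (simp add: mod_eq_0_iff_dvd)
  qed
qed

lemma words_equal_shifts:
  assumes w: "w \<in> words n" and n: "0 < n" and "j \<le> k" and eq: "\<And>r. w (j + r) = w (k + r)"
  shows "w \<in> words (k - j)"
proof -
  have "w (x + (k - j)) = w x" for x
  proof -
    \<comment> \<open>Adding \<open>n * j\<close>, a multiple of the period, moves any position to
      one not below \<open>j\<close>, where the hypothesis applies.\<close>
    have le: "j \<le> n * j" using n by simp
    have "j + (x + n * j - j) = x + n * j" "k + (x + n * j - j) = x + (k - j) + n * j"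
      using \<open>j \<le> k\<close> le by linarith+
    then have "w (x + (k - j) + n * j) = w (x + n * j)" using eq by metis
    then show ?thesis using words_add_mult[OF w] by simp
  qed
  then show ?thesis using w by (simp add: words_def)
qed

text \<open>At the first place where the shifts differ the letters decide the comparison; the common
  prefix carries the decision back with a sign that depends only on \<open>w\<close>.\<close>

lemma orders_sgn_unique:
  assumes f: "f \<in> orders t n w" and g: "g \<in> orders t n w" and "\<exists>r. w (j + r) \<noteq> w (k + r)"
  shows "sgn (int (f k) - int (f j)) = sgn (int (g k) - int (g j))"
proof -
  define m where "m = (LEAST r. w (j + r) \<noteq> w (k + r))"
  have ne: "w (j + m) \<noteq> w (k + m)" unfolding m_def using assms(3) by (rule LeastI_ex)
  have eq: "w (j + r) = w (k + r)" if "r < m" for r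
    using not_less_Least that unfolding m_def by blast
  have "sgn (int (h (k + m)) - int (h (j + m))) = sgn (int (w (k + m)) - int (w (j + m)))"
    if "h \<in> orders t n w" for h
    using ne orders_letter_less[OF that, of "j + m" "k + m"]
      orders_letter_less[OF that, of "k + m" "j + m"]
    by (cases "w (j + m)" "w (k + m)" rule: linorder_cases) auto
  then show ?thesis
    using orders_common_prefix[OF f eq] orders_common_prefix[OF g eq] f g by simp
qed

text \<open>Two equal shifts would give a period shorter than \<open>n\<close>, so the word forces
  every comparison.\<close>

lemma orders_primitive_unique:
  assumes "f \<in> orders t n w" "g \<in> orders t n w" "w \<in> primitive_words n" "0 < n"
  shows "f = g"
proof (rule orders_eqI[OF assms(1,2,4)], rule orders_sgn_unique[OF assms(1,2)], rule ccontr)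
  fix j k assume "j < k" "k < n" "\<nexists>r. w (j + r) \<noteq> w (k + r)"
  then have "w \<in> words (k - j)"
    using assms(3,4) by (intro words_equal_shifts) (auto simp: primitive_words_def)
  then show False using assms(3) \<open>j < k\<close> \<open>k < n\<close> by (auto simp: primitive_words_def)
qed

text \<open>The word leaves open only comparisons of positions at distance \<open>d\<close>, and
  these all follow from the one between 0 and \<open>d\<close> through a prefix sign. So there is a
  single binary choice.\<close>

lemma orders_square_unique:
  assumes f: "f \<in> orders t (2 * d) w" and g: "g \<in> orders t (2 * d) w"
    and w: "w \<in> primitive_words d" and d: "0 < d"
    and same: "sgn (int (f d) - int (f 0)) = sgn (int (g d) - int (g 0))"
  shows "f = g"
proof (rule orders_eqI[OF f g])
  show "0 < 2 * d" using d by simp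
  fix j k assume jk: "j < k" "k < 2 * d"
  have wd: "w \<in> words d" using w by (simp add: primitive_words_def)
  show "sgn (int (f k) - int (f j)) = sgn (int (g k) - int (g j))"
  proof (cases "\<exists>r. w (j + r) \<noteq> w (k + r)")
    case True
    then show ?thesis by (rule orders_sgn_unique[OF f g])
  next
    case False
    then have "w \<in> words (k - j)" using words_equal_shifts[OF wd d, of j k] jk by simp
    then have "d dvd k - j" using primitive_words_dvd[OF w _ d] by simp
    then obtain q where q: "k - j = d * q" by auto
    \<comment> \<open>A positive multiple of \<open>d\<close> below \<open>2 * d\<close> is
      \<open>d\<close> itself.\<close>
    have "d * q < d * 2" "d * q \<noteq> 0" using jk unfolding q[symmetric] by auto
    then have "q = 1" by simp
    then have k: "k = d + j" using q jk by simp
    have eq: "w (0 + r) = w (d + r)" for r using wd by (simp add: words_def add.commute[of d])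
    have "(\<Prod>r<j. letter_sign t (w r)) * sgn (int (f k) - int (f j))
        = (\<Prod>r<j. letter_sign t (w r)) * sgn (int (g k) - int (g j))"
      using orders_common_prefix[OF f eq, of j] orders_common_prefix[OF g eq, of j] same k by simp
    then show ?thesis by simp
  qed
qed

text \<open>Let \<open>d < n\<close> be the primitive period. Sign 1 over \<open>d\<close> letters
  would make \<open>n\<close> divide \<open>d\<close>; so the sign is -1, the sign over
  \<open>2 * d\<close> letters is 1, and \<open>n\<close> divides \<open>2 * d\<close>. This leaves
  only \<open>n = 2 * d\<close>, the excluded case.\<close>

lemma orders_empty:
  assumes "w \<in> words n" "0 < n" "w \<notin> primitive_words n"
    and "\<not> (\<exists>d. n = 2 * d \<and> w \<in> primitive_words d \<and> (\<Prod>i<d. letter_sign t (w i)) = -1)"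
  shows "orders t n w = {}"
proof (rule ccontr)
  assume "orders t n w \<noteq> {}"
  then obtain f where f: "f \<in> orders t n w" by auto
  obtain d where d: "0 < d" "d \<le> n" "w \<in> primitive_words d"
    using primitive_period_exists assms by blast
  then have wd: "w \<in> words d" by (simp add: primitive_words_def)
  have "d < n" using d assms by (cases "d = n") auto
  then have neg: "(\<Prod>i<d. letter_sign t (w i)) = -1"
    using prod_letter_sign_cases[of t w d] orders_positive_period[OF f wd assms(2)] d
    by (metis dvd_imp_le not_less)
  have "n dvd d * 2"
    using orders_positive_period[OF f words_mult[OF wd] assms(2), of 2]
      prod_words_mult[OF wd, of "letter_sign t" 2] neg by simp
  then obtain q where q: "d * 2 = n * q" by auto
  have "q < 2"
  proof (rule ccontr)
    assume "\<not> q < 2"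
    then have "n * 2 \<le> n * q" by simp
    then show False using \<open>d < n\<close> unfolding q[symmetric] by simp
  qed
  moreover have "q \<noteq> 0" using q d by (metis mult_0_right mult_eq_0_iff less_irrefl zero_neq_numeral)
  ultimately have "q = 1" by simp
  then show False using q d neg assms(4) by auto
qed

section \<open>Compatible orders from linear orders of the positions\<close>

lemma rank_function_exists:
  fixes L :: "nat \<Rightarrow> nat \<Rightarrow> bool"
  assumes irrefl: "\<And>j. \<not> L j j" and trans: "\<And>i j k. L i j \<Longrightarrow> L j k \<Longrightarrow> L i k"
    and total: "\<And>j k. j < n \<Longrightarrow> k < n \<Longrightarrow> j \<noteq> k \<Longrightarrow> L j k \<or> L k j"
  shows "\<exists>f. bij_betw f {..<n} {1..n} \<and> (\<forall>j<n. \<forall>k<n. f j < f k \<longleftrightarrow> L j k)"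
proof -
  \<comment> \<open>The rank is one plus the number of predecessors; counting from 1 lets the values
    land in \<open>{1..n}\<close>.\<close>
  define f where "f j = Suc (card {i. i < n \<and> L i j})" for j
  have less: "f j < f k" if "L j k" "j < n" for j k
  proof -
    have "{i. i < n \<and> L i j} \<subset> {i. i < n \<and> L i k}"
      using that irrefl trans by blast
    then show ?thesis unfolding f_def by (simp add: psubset_card_mono)
  qed
  have iff: "f j < f k \<longleftrightarrow> L j k" if "j < n" "k < n" for j k
    using less total[OF that] that by (metis less_asym less_irrefl)
  have inj: "inj_on f {..<n}"
    using total less by (intro inj_onI) (metis lessThan_iff less_irrefl)
  have "f ` {..<n} \<subseteq> {1..n}"
  proof
    fix x assume "x \<in> f ` {..<n}"
    then obtain j where j: "j < n" "x = f j" by auto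
    have "card {i. i < n \<and> L i j} \<le> card ({..<n} - {j})"
      using irrefl by (intro card_mono) auto
    then show "x \<in> {1..n}" using j by (simp add: f_def)
  qed
  then have "f ` {..<n} = {1..n}"
    using inj by (intro card_subset_eq) (auto simp: card_image)
  then show ?thesis using inj iff by (auto simp: bij_betw_def)
qed

text \<open>Ranks are taken on residues modulo \<open>n\<close> and extended periodically, which
  \<open>period\<close> permits. The hypothesis \<open>step\<close>, by which negative letters
  reverse a comparison, becomes the sign clause of \<open>orders\<close>.\<close>

lemma orders_of_relation:
  fixes L :: "nat \<Rightarrow> nat \<Rightarrow> bool"
  assumes n: "0 < n"
    and irrefl: "\<And>j. \<not> L j j" and trans: "\<And>i j k. L i j \<Longrightarrow> L j k \<Longrightarrow> L i k"
    and total: "\<And>j k. j < n \<Longrightarrow> k < n \<Longrightarrow> j \<noteq> k \<Longrightarrow> L j k \<or> L k j"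
    and period: "\<And>j k. L (j mod n) (k mod n) \<longleftrightarrow> L j k"
    and letter: "\<And>j k. w j < w k \<Longrightarrow> L j k"
    and step: "\<And>j k. w j = w k \<Longrightarrow>
      L j k \<longleftrightarrow> (if letter_sign t (w j) = 1 then L (Suc j) (Suc k) else L (Suc k) (Suc j))"
  shows "\<exists>f \<in> orders t n w. \<forall>j k. f j < f k \<longleftrightarrow> L j k"
proof -
  obtain g where g: "bij_betw g {..<n} {1..n}" "\<forall>j<n. \<forall>k<n. g j < g k \<longleftrightarrow> L j k"
    using rank_function_exists[of L n] irrefl trans total by blast
  define f where "f j = g (j mod n)" for j
  have less: "f j < f k \<longleftrightarrow> L j k" for j k
    using g(2) n period[of j k] by (simp add: f_def)
  then have sgn: "sgn (int (f k) - int (f j)) = (if L j k then 1 else if L k j then -1 else 0)" for j k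
    by (smt (verit, best) of_nat_less_iff sgn_if)
  have "f \<in> orders t n w"
    unfolding orders_def
  proof (intro CollectI conjI allI impI)
    show "f (j + n) = f j" for j by (simp add: f_def)
    show "bij_betw f {..<n} {1..n}"
      using g(1) by (rule bij_betw_cong[THEN iffD1, rotated]) (simp add: f_def)
    show "f j < f k" if "w j < w k" for j k using that letter less by simp
    show "sgn (int (f k) - int (f j))
        = letter_sign t (w j) * sgn (int (f (Suc k)) - int (f (Suc j)))" if "w j = w k" for j k
      using step[OF that] step[OF that[symmetric]] letter_sign_cases[of t "w j"] that
        trans irrefl unfolding sgn by auto
  qed
  with less show ?thesis by blast
qed

subsection \<open>Existence of compatible orders\<close>

text \<open>A periodic word is coded by a real number as in a signed base-4 expansion; the digits
  \<open>-1, 0, 1\<close> in base 4 leave gaps, so that the coding reflects the first letter strictly.\<close>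

lemma signed_expansion_exists:
  assumes w: "w \<in> words n"
  shows "\<exists>Y :: nat \<Rightarrow> real. (\<forall>j. \<bar>Y j\<bar> \<le> 4/3) \<and> 
    (\<forall>j k. (\<forall>r. w (j + r) = w (k + r)) \<longrightarrow> Y j = Y k) \<and>
    (\<forall>j. Y j = real (w j) - 1 + real_of_int (letter_sign t (w j)) / 4 * Y (Suc j))"
proof -
  \<comment> \<open>\<open>P j r\<close> is the sign of the \<open>r\<close> letters from position
    \<open>j\<close> on. In the series with terms \<open>a j r\<close> a negative letter thus
    negates all later terms, and splitting off the first letter yields the recursion for
    \<open>Y\<close>.\<close>
  define P where "P j r = real_of_int (\<Prod>i<r. letter_sign t (w (j + i)))" for j r
  define a where "a j r = P j r * (real (w (j + r)) - 1) / 4 ^ r" for j r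
  have P_Suc: "P j (Suc r) = real_of_int (letter_sign t (w j)) * P (Suc j) r" for j r
    unfolding P_def by (subst prod.lessThan_Suc_shift) simp
  have bound: "\<bar>a j r\<bar> \<le> (1/4) ^ r" for j r
  proof -
    have "\<bar>P j r\<bar> = 1"
      using prod_letter_sign_cases[of t "\<lambda>i. w (j + i)" r]
      unfolding P_def by (elim disjE) (simp_all only: of_int_1 of_int_minus abs_minus abs_one)
    moreover have "\<bar>real (w (j + r)) - 1\<bar> \<le> 1"
    proof -
      have "w (j + r) < 3" using w by (simp add: words_def)
      then show ?thesis by linarith
    qed
    ultimately show ?thesis
      by (simp add: a_def abs_mult power_one_over divide_simps)
  qed
  have geo: "summable (\<lambda>r. (1/4 :: real) ^ r)" by simp
  have sum_abs: "summable (\<lambda>r. \<bar>a j r\<bar>)" for j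
    by (rule summable_comparison_test'[OF geo, of 0]) (use bound in simp)
  then have sum: "summable (a j)" for j by (rule summable_rabs_cancel)
  define Y where "Y j = suminf (a j)" for j
  have "\<bar>Y j\<bar> \<le> 4/3" for j
  proof -
    have "\<bar>Y j\<bar> \<le> (\<Sum>r. \<bar>a j r\<bar>)" unfolding Y_def by (rule summable_rabs[OF sum_abs])
    also have "\<dots> \<le> (\<Sum>r. (1/4) ^ r)" by (rule suminf_le[OF bound sum_abs geo])
    also have "\<dots> = 4/3" by (subst suminf_geometric) auto
    finally show ?thesis .
  qed
  moreover have "Y j = Y k" if "\<forall>r. w (j + r) = w (k + r)" for j k
    using that by (simp add: Y_def a_def[abs_def] P_def)
  moreover have "Y j = real (w j) - 1 + real_of_int (letter_sign t (w j)) / 4 * Y (Suc j)" for j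
  proof -
    have "a j (Suc r) = real_of_int (letter_sign t (w j)) / 4 * a (Suc j) r" for r
      by (simp add: a_def P_Suc)
    then have "(\<Sum>r. a j (Suc r)) = real_of_int (letter_sign t (w j)) / 4 * Y (Suc j)"
      unfolding Y_def by (simp only: suminf_mult[OF sum])
    moreover have "a j 0 = real (w j) - 1" by (simp add: a_def P_def)
    ultimately show ?thesis using suminf_split_head[OF sum, of j] by (simp add: Y_def)
  qed
  ultimately show ?thesis by blast
qed

text \<open>\<open>T\<close> orders positions whose shifts coincide. \<open>T_step\<close> makes it
  reverse at negative letters exactly as a compatible order does, and \<open>T_tie\<close> makes the
  resulting order total. At periods of \<open>w\<close> the expansion cannot distinguish positions,
  so there \<open>T\<close> alone decides, as the conclusion records.\<close>

lemma orders_exists: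
  fixes T :: "nat \<Rightarrow> int"
  assumes w: "w \<in> words n" and n: "0 < n" and Tn: "\<And>j. T (j + n) = T j"
    and T_step: "\<And>j. T (Suc j) = letter_sign t (w j) * T j"
    and T_tie: "\<And>j k. j < k \<Longrightarrow> k < n \<Longrightarrow> w \<in> words (k - j) \<Longrightarrow> T j \<noteq> T k"
  shows "\<exists>f \<in> orders t n w. \<forall>j. w \<in> words j \<longrightarrow> (f 0 < f j \<longleftrightarrow> T 0 < T j)"
proof -
  obtain Y :: "nat \<Rightarrow> real" where bound: "\<And>j. \<bar>Y j\<bar> \<le> 4/3" 
    and Y_cong: "\<And>j k. \<forall>r. w (j + r) = w (k + r) \<Longrightarrow> Y j = Y k"
    and Y: "\<And>j. Y j = real (w j) - 1 + real_of_int (letter_sign t (w j)) / 4 * Y (Suc j)"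
    using signed_expansion_exists[OF w, of t] by blast
  have Y_period: "Y (j + d) = Y j" if "w \<in> words d" for j d
  proof (rule Y_cong, rule allI)
    show "w (j + d + r) = w (j + r)" for r
      using words_add_mult[OF that, of "j + r" 1] by (simp add: algebra_simps)
  qed
  \<comment> \<open>The leading digits differ by at least 1, while each tail is at most a quarter of
    4/3, that is 1/3, in absolute value.\<close>
  have letter: "Y j < Y k" if "w j < w k" for j k
  proof -
    have "real (w j) + 1 \<le> real (w k)" using that by simp
    then show ?thesis
      using Y[of j] Y[of k] bound[of "Suc j"] bound[of "Suc k"]
        letter_sign_cases[of t "w j"] letter_sign_cases[of t "w k"]
      by (auto simp: abs_le_iff)
  qed
  have Y_step: "Y j < Y k \<longleftrightarrow>
      (if letter_sign t (w j) = 1 then Y (Suc j) < Y (Suc k) else Y (Suc k) < Y (Suc j))"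
    if "w j = w k" for j k
    using Y[of j] Y[of k] that letter_sign_cases[of t "w j"] by auto
  \<comment> \<open>Equal values force equal letters and again equal values one step later, so a tie
    in \<open>Y\<close> is a coincidence of shifts.\<close>
  have Y_eq: "w j = w k" "Y (Suc j) = Y (Suc k)" if "Y j = Y k" for j k
  proof -
    show eq: "w j = w k"
      using that letter[of j k] letter[of k j] by (cases "w j" "w k" rule: linorder_cases) auto
    show "Y (Suc j) = Y (Suc k)" using Y[of j] Y[of k] eq that letter_sign_cases[of t "w j"] by auto
  qed
  have Y_eq_iff: "Y j = Y k \<longleftrightarrow> Y (Suc j) = Y (Suc k)" if "w j = w k" for j k
    using Y[of j] Y[of k] that letter_sign_cases[of t "w j"] by auto
  have Y_shift: "Y (j + r) = Y (k + r)" if "Y j = Y k" for j k r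
  proof (induction r)
    case (Suc r)
    then show ?case using Y_eq(2)[OF Suc] by simp
  qed (use that in simp)
  \<comment> \<open>Lexicographic comparison: first the expansion, then the tie-breaker.\<close>
  define L where "L j k \<longleftrightarrow> Y j < Y k \<or> Y j = Y k \<and> T j < T k" for j k
  have "\<exists>f \<in> orders t n w. \<forall>j k. f j < f k \<longleftrightarrow> L j k"
  proof (rule orders_of_relation[OF n])
    show "\<not> L j j" for j by (simp add: L_def)
    show "L i k" if "L i j" "L j k" for i j k using that by (auto simp: L_def)
    show "L (j mod n) (k mod n) \<longleftrightarrow> L j k" for j k
      by (simp add: L_def periodic_mod[of Y n, OF Y_period[OF w]] periodic_mod[of T n, OF Tn])
    show "L j k" if "w j < w k" for j k using letter[OF that] by (simp add: L_def)
    show "L j k \<longleftrightarrow> (if letter_sign t (w j) = 1 then L (Suc j) (Suc k) else L (Suc k) (Suc j))"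
      if "w j = w k" for j k
    proof (cases "letter_sign t (w j) = 1")
      case True
      then have "T (Suc j) = T j" "T (Suc k) = T k" using T_step that by simp_all
      then show ?thesis unfolding L_def using Y_step[OF that] Y_eq_iff[OF that] True by argo
    next
      case False
      then have "letter_sign t (w j) = -1" using letter_sign_cases by blast
      then have "T (Suc j) = - T j" "T (Suc k) = - T k" using T_step that by simp_all
      then have "T j < T k \<longleftrightarrow> T (Suc k) < T (Suc j)" by simp
      then show ?thesis unfolding L_def using Y_step[OF that] Y_eq_iff[OF that] False by auto
    qed
    have ne: "Y j \<noteq> Y k \<or> T j \<noteq> T k" if "j < k" "k < n" for j k
    proof (cases "Y j = Y k")
      case True
      have "w \<in> words (k - j)"
        by (rule words_equal_shifts[OF w n]) (use that Y_eq(1)[OF Y_shift[OF True]] in auto)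
      then show ?thesis using T_tie[OF that] by simp
    qed simp
    show "L j k \<or> L k j" if "j < n" "k < n" "j \<noteq> k" for j k
      using ne[of j k] ne[of k j] that unfolding L_def
      by (cases j k rule: linorder_cases) auto
  qed
  moreover have "Y 0 = Y j" if "w \<in> words j" for j
    using Y_period[OF that, of 0] by simp
  ultimately show ?thesis unfolding L_def by (metis less_irrefl)
qed

section \<open>Counting the compatible orders of all words\<close>

lemma card_orders_primitive:
  assumes "w \<in> primitive_words n" "0 < n"
  shows "card (orders t n w) = 1"
proof -
  \<comment> \<open>The zero tie-breaker suffices: a primitive word has no positive period below
    \<open>n\<close>, so there is nothing to separate.\<close>
  have "\<exists>f. f \<in> orders t n w"
    using orders_exists[of w n "\<lambda>_. 0" t] assms by (auto simp: primitive_words_def)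
  then obtain f where "f \<in> orders t n w" by blast
  then have "orders t n w = {f}" using orders_primitive_unique assms by blast
  then show ?thesis by simp
qed

text \<open>Uniqueness leaves at most one order for each comparison of positions 0 and
  \<open>d\<close>. Both occur: \<open>T b j\<close>, which is \<open>b\<close> times the sign of
  the first \<open>j\<close> letters, changes sign under a shift by \<open>d\<close>, and
  \<open>b = -1\<close>, \<open>b = 1\<close> give the two comparisons.\<close>

lemma card_orders_square:
  assumes w: "w \<in> primitive_words d" and d: "0 < d"
    and neg: "(\<Prod>i<d. letter_sign t (w i)) = -1"
  shows "card (orders t (2 * d) w) = 2"
proof -
  have wd: "w \<in> words d" using w by (simp add: primitive_words_def)
  define T where "T b j = b * (\<Prod>i<j. letter_sign t (w i))" for b :: int and j :: nat
  have T_shift: "T b (j + d) = - T b j" for b j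
  proof -
    have "(\<Prod>i<j. letter_sign t (w (d + i))) = (\<Prod>i<j. letter_sign t (w i))"
      using wd by (simp add: words_def add.commute[of d])
    then show ?thesis unfolding T_def add.commute[of j] prod_lessThan_add neg by simp
  qed
  have ex: "\<exists>f \<in> orders t (2 * d) w. \<forall>j. w \<in> words j \<longrightarrow> (f 0 < f j \<longleftrightarrow> T b 0 < T b j)"
    if "b \<noteq> 0" for b
  proof (rule orders_exists)
    show "w \<in> words (2 * d)" using words_mult[OF wd, of 2] by (simp add: mult.commute)
    show "T b (j + 2 * d) = T b j" for j
      using T_shift[of b "j + d"] T_shift[of b j] by (simp add: add.assoc mult_2)
    show "T b (Suc j) = letter_sign t (w j) * T b j" for j by (simp add: T_def)
    show "T b j \<noteq> T b k" if jk: "j < k" "k < 2 * d" "w \<in> words (k - j)" for j k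
    proof -
      obtain q where q: "k - j = d * q" using primitive_words_dvd[OF w jk(3) d] by auto
      have "d * q < d * 2" "d * q \<noteq> 0" using jk unfolding q[symmetric] by auto
      then have "q = 1" by simp
      then have "k = j + d" using q jk by simp
      moreover have "T b j \<noteq> 0"
        using \<open>b \<noteq> 0\<close> by (simp add: T_def)
      ultimately show ?thesis using T_shift by simp
    qed
  qed (use d in simp)
  have T0: "T b 0 = b" "T b d = - b" for b by (simp_all add: T_def neg)
  obtain f where f: "f \<in> orders t (2 * d) w" "f 0 < f d" using ex[of "-1"] wd T0 by auto
  obtain g where g: "g \<in> orders t (2 * d) w" "\<not> g 0 < g d" using ex[of 1] wd T0 by auto
  have ne: "h d \<noteq> h 0" if "h \<in> orders t (2 * d) w" for h
    using orders_eq_iff[OF that, of d 0] d by simp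
  have "orders t (2 * d) w = {f, g}"
  proof
    show "orders t (2 * d) w \<subseteq> {f, g}"
    proof
      fix h assume h: "h \<in> orders t (2 * d) w"
      show "h \<in> {f, g}"
      proof (cases "h 0 < h d")
        case True
        then have "h = f" using f by (intro orders_square_unique[OF h f(1) w d]) simp
        then show ?thesis by simp
      next
        case False
        then have "h = g" using g ne[OF h] ne[OF g(1)]
          by (intro orders_square_unique[OF h g(1) w d]) simp
        then show ?thesis by simp
      qed
    qed
  qed (use f g in auto)
  moreover have "f \<noteq> g" using f g by auto
  ultimately show ?thesis by simp
qed

text \<open>Primitive words contribute 1 each, squares of negative primitive words 2 each, and all
  others 0. Only the second count involves \<open>t\<close>, and it is the same for both values if
  \<open>1 < d\<close>; for \<open>d = 1\<close> there is one negative letter for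
  \<open>True\<close> but two for \<open>False\<close>.\<close>

lemma card_orders_even:
  assumes "1 < d"
  shows "(\<Sum>w\<in>words (2 * d). card (orders True (2 * d) w))
       = (\<Sum>w\<in>words (2 * d). card (orders False (2 * d) w))"
proof -
  define neg where "neg t = {w \<in> primitive_words d. (\<Prod>i<d. letter_sign t (w i)) = -1}" for t
  have "(\<Sum>w\<in>words (2 * d). card (orders t (2 * d) w))
      = card (primitive_words (2 * d)) + 2 * card (neg t)" for t
  proof -
    have fin: "finite (primitive_words (2 * d))" "finite (neg t)"
      using assms finite_primitive_words by (auto simp: neg_def)
    have sub: "primitive_words (2 * d) \<union> neg t \<subseteq> words (2 * d)"
      using words_mult[of _ d 2] by (auto simp: primitive_words_def neg_def mult.commute)
    have disj: "primitive_words (2 * d) \<inter> neg t = {}"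
      using assms primitive_words_unique[of _ "2 * d" d] by (auto simp: neg_def)
    have "(\<Sum>w\<in>words (2 * d). card (orders t (2 * d) w))
        = (\<Sum>w\<in>primitive_words (2 * d) \<union> neg t. card (orders t (2 * d) w))"
      using assms finite_words sub orders_empty[of _ "2 * d" t]
      by (intro sum.mono_neutral_right) (auto simp: neg_def)
    also have "\<dots> = (\<Sum>w\<in>primitive_words (2 * d). card (orders t (2 * d) w))
        + (\<Sum>w\<in>neg t. card (orders t (2 * d) w))"
      using fin disj by (rule sum.union_disjoint)
    also have "(\<Sum>w\<in>primitive_words (2 * d). card (orders t (2 * d) w)) = card (primitive_words (2 * d))"
      using card_orders_primitive assms by simp
    also have "(\<Sum>w\<in>neg t. card (orders t (2 * d) w)) = 2 * card (neg t)"
      using card_orders_square assms by (simp add: neg_def)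
    finally show ?thesis .
  qed
  moreover have "card (neg True) = card (neg False)"
    unfolding neg_def using assms by (rule card_negative_primitive_words)
  ultimately show ?thesis by simp
qed

text \<open>Words of odd length are not squares of shorter words, so only primitive ones contribute,
  and the count is free of \<open>t\<close>.\<close>

lemma card_orders_odd:
  assumes "odd n"
  shows "(\<Sum>w\<in>words n. card (orders t n w)) = card (primitive_words n)"
proof -
  have n: "0 < n" using assms by (rule odd_pos)
  have "(\<Sum>w\<in>words n. card (orders t n w)) = (\<Sum>w\<in>primitive_words n. card (orders t n w))"
  proof (rule sum.mono_neutral_right)
    show "\<forall>w\<in>words n - primitive_words n. card (orders t n w) = 0"
    proof
      fix w assume "w \<in> words n - primitive_words n"
      then have "orders t n w = {}" using assms n by (intro orders_empty) auto
      then show "card (orders t n w) = 0" by simp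
    qed
  qed (use n finite_words in \<open>auto simp: primitive_words_def\<close>)
  then show ?thesis using card_orders_primitive n by simp
qed

lemma sum_card_orders_eq:
  assumes "3 \<le> n"
  shows "(\<Sum>w\<in>words n. card (orders True n w)) = (\<Sum>w\<in>words n. card (orders False n w))"
proof (cases "even n")
  case True
  then obtain d where "n = 2 * d" by auto
  then show ?thesis using card_orders_even[of d] assms by simp
next
  case False
  then show ?thesis by (simp add: card_orders_odd)
qed

subsection \<open>Segmentations\<close>

definition label :: "nat \<Rightarrow> nat \<Rightarrow> nat \<Rightarrow> nat" where
  "label a b x = (if x \<le> a then 0 else if x \<le> b then 1 else 2)"

text \<open>\<open>a\<close> and \<open>b\<close> play the role of \<open>e 1\<close> and
  \<open>e 2\<close>. Monotonicity is phrased as an identity of signs so as to match the last clause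
  of \<open>orders\<close>.\<close>

definition segmentations :: "bool \<Rightarrow> nat \<Rightarrow> (nat \<Rightarrow> nat) \<Rightarrow> (nat \<times> nat) set" where
  "segmentations t n p = {(a, b). a \<le> b \<and> b \<le> n \<and>
     (\<forall>x\<in>{1..n}. \<forall>y\<in>{1..n}. label a b x = label a b y \<longrightarrow>
        sgn (int y - int x) = letter_sign t (label a b x) * sgn (int (p y) - int (p x)))}"

lemma in_sig_class_iff:
  "in_sig_class [t, \<not> t, t] n p \<longleftrightarrow> perm_of n p \<and> segmentations t n p \<noteq> {}"
proof -
  \<comment> \<open>Monotonicity on an interval, brought into the symmetric sign form of
    \<open>segmentations\<close>.\<close>
  have mono_iff: "(\<forall>a b. l + 1 \<le> a \<and> a < b \<and> b \<le> u \<longrightarrow> (if s then p a < p b else p b < p a)) \<longleftrightarrow>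
      (\<forall>x y. l < x \<and> x \<le> u \<and> l < y \<and> y \<le> u \<longrightarrow>
        sgn (int y - int x) = (if s then 1 else -1) * sgn (int (p y) - int (p x)))"
    (is "?A \<longleftrightarrow> ?B") for l u s
  proof
    assume A: ?A
    show ?B
    proof (intro allI impI)
      fix x y assume "l < x \<and> x \<le> u \<and> l < y \<and> y \<le> u"
      then show "sgn (int y - int x) = (if s then 1 else -1) * sgn (int (p y) - int (p x))"
        using A[rule_format, of x y] A[rule_format, of y x]
        by (cases x y rule: linorder_cases; cases s) auto
    qed
  next
    assume B: ?B
    show ?A
    proof (intro allI impI)
      fix x y assume "l + 1 \<le> x \<and> x < y \<and> y \<le> u"
      then show "if s then p x < p y else p y < p x"
        using B[rule_format, of x y] by (cases s) (auto simp: sgn_if split: if_splits)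
    qed
  qed
  have seg_iff: "(a, b) \<in> segmentations t n p \<longleftrightarrow> a \<le> b \<and> b \<le> n \<and>
      (\<forall>x y. 0 < x \<and> x \<le> a \<and> 0 < y \<and> y \<le> a \<longrightarrow>
        sgn (int y - int x) = (if t then 1 else -1) * sgn (int (p y) - int (p x))) \<and>
      (\<forall>x y. a < x \<and> x \<le> b \<and> a < y \<and> y \<le> b \<longrightarrow>
        sgn (int y - int x) = (if \<not> t then 1 else -1) * sgn (int (p y) - int (p x))) \<and>
      (\<forall>x y. b < x \<and> x \<le> n \<and> b < y \<and> y \<le> n \<longrightarrow>
        sgn (int y - int x) = (if t then 1 else -1) * sgn (int (p y) - int (p x)))"
    (is "?L \<longleftrightarrow> ?a \<and> ?b \<and> ?R1 \<and> ?R2 \<and> ?R3") for a b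
  proof
    assume ?L
    then have ab: ?a ?b and S: "\<And>x y. x \<in> {1..n} \<Longrightarrow> y \<in> {1..n} \<Longrightarrow> label a b x = label a b y \<Longrightarrow>
        sgn (int y - int x) = letter_sign t (label a b x) * sgn (int (p y) - int (p x))"
      by (auto simp: segmentations_def)
    have ?R1 ?R2 ?R3
      using ab by (auto simp: S label_def letter_sign_def)
    with ab show "?a \<and> ?b \<and> ?R1 \<and> ?R2 \<and> ?R3" by blast
  next
    assume R: "?a \<and> ?b \<and> ?R1 \<and> ?R2 \<and> ?R3"
    have "sgn (int y - int x) = letter_sign t (label a b x) * sgn (int (p y) - int (p x))"
      if xy: "x \<in> {1..n}" "y \<in> {1..n}" "label a b x = label a b y" for x y
    proof -
      consider "x \<le> a" "y \<le> a" | "a < x" "x \<le> b" "a < y" "y \<le> b" | "b < x" "b < y"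
        using xy(3)
        by (cases "x \<le> a"; cases "x \<le> b"; cases "y \<le> a"; cases "y \<le> b") (auto simp: label_def)
      then show ?thesis
      proof cases
        case 1
        then show ?thesis using R xy by (simp add: label_def letter_sign_def)
      next
        case 2
        then show ?thesis using R by (simp add: label_def letter_sign_def)
      next
        case 3
        then show ?thesis using R xy by (simp add: label_def letter_sign_def)
      qed
    qed
    with R show ?L by (simp add: segmentations_def)
  qed
  have all3: "(\<forall>i<3. P i) \<longleftrightarrow> P 0 \<and> P 1 \<and> P (2::nat)" for P
    by (simp add: numeral_3_eq_3 numeral_2_eq_2 less_Suc_eq) blast
  show ?thesis
  proof
    assume "in_sig_class [t, \<not> t, t] n p"
    then obtain e where "perm_of n p" "e 0 = 0" "e 3 = n"
      "\<forall>i<3. e i \<le> e (Suc i)"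
      "\<forall>i<3. \<forall>a b. e i + 1 \<le> a \<and> a < b \<and> b \<le> e (Suc i) \<longrightarrow>
            (if [t, \<not> t, t] ! i then p a < p b else p b < p a)"
      unfolding in_sig_class_def by (auto simp: numeral_3_eq_3)
    then have "(e 1, e 2) \<in> segmentations t n p"
      unfolding seg_iff mono_iff all3 by (simp add: numeral_3_eq_3 numeral_2_eq_2)
    then show "perm_of n p \<and> segmentations t n p \<noteq> {}" using \<open>perm_of n p\<close> by blast
  next
    assume "perm_of n p \<and> segmentations t n p \<noteq> {}"
    then obtain a b where p: "perm_of n p" and ab: "(a, b) \<in> segmentations t n p" by auto
    define e where "e i = (if i = 0 then 0 else if i = 1 then a else if i = 2 then b else n)" for i :: nat
    have "(\<forall>i<3. e i \<le> e (Suc i)) \<and>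
      (\<forall>i<3. \<forall>a b. e i + 1 \<le> a \<and> a < b \<and> b \<le> e (Suc i) \<longrightarrow>
            (if [t, \<not> t, t] ! i then p a < p b else p b < p a))"
      using ab unfolding seg_iff mono_iff all3 by (simp add: e_def numeral_2_eq_2)
    moreover have "e 0 = 0" "e 3 = n" by (simp_all add: e_def)
    ultimately show "in_sig_class [t, \<not> t, t] n p"
      unfolding in_sig_class_def using p by (auto simp: numeral_3_eq_3 intro!: exI[of _ e])
  qed
qed

section \<open>Neighbouring values and the number of segmentations\<close>

lemma sgn_monotone_chain:
  fixes q :: "nat \<Rightarrow> int"
  assumes "x < y" "c = 1 \<or> c = -1"
    and "\<And>z. x \<le> z \<Longrightarrow> z < y \<Longrightarrow> sgn (q (Suc z) - q z) = c"
  shows "sgn (q y - q x) = c"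
  using assms
proof (induction y)
  case (Suc y)
  show ?case
  proof (cases "x = y")
    case False
    then have "sgn (q y - q x) = c" using Suc by simp
    moreover have "sgn (q (Suc y) - q y) = c" using Suc by simp
    ultimately show ?thesis using Suc.prems(2) by (auto simp: sgn_if split: if_splits)
  qed (use Suc in simp)
qed simp

text \<open>Inside a segment the comparisons of neighbours suffice by transitivity. The steps from
  \<open>a\<close> and from \<open>b\<close> are exempt because they lead into another
  segment.\<close>

lemma segmentations_iff_adjacent:
  assumes "perm_of n p"
  shows "(a, b) \<in> segmentations t n p \<longleftrightarrow> a \<le> b \<and> b \<le> n \<and>
    (\<forall>x. 1 \<le> x \<and> x < n \<and> x \<noteq> a \<and> x \<noteq> b \<longrightarrow>
      sgn (int (p (Suc x)) - int (p x)) = letter_sign t (label a b x))"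
    (is "?L \<longleftrightarrow> a \<le> b \<and> b \<le> n \<and> ?R")
proof
  assume L: ?L
  have ?R
  proof (intro allI impI)
    fix x assume x: "1 \<le> x \<and> x < n \<and> x \<noteq> a \<and> x \<noteq> b"
    then have "label a b x = label a b (Suc x)" by (auto simp: label_def)
    moreover have "x \<in> {1..n}" "Suc x \<in> {1..n}" using x by auto
    ultimately have "sgn (int (Suc x) - int x)
        = letter_sign t (label a b x) * sgn (int (p (Suc x)) - int (p x))"
      using L unfolding segmentations_def by blast
    then show "sgn (int (p (Suc x)) - int (p x)) = letter_sign t (label a b x)"
      using letter_sign_cases[of t "label a b x"] by auto
  qed
  with L show "a \<le> b \<and> b \<le> n \<and> ?R" by (simp add: segmentations_def)
next
  assume R: "a \<le> b \<and> b \<le> n \<and> ?R"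
  have adj: "sgn (int (p y) - int (p x)) = letter_sign t (label a b x)"
    if "1 \<le> x" "x < y" "y \<le> n" "label a b x = label a b y" for x y
  proof (rule sgn_monotone_chain[OF \<open>x < y\<close> letter_sign_cases])
    fix z assume z: "x \<le> z" "z < y"
    then have "label a b z = label a b x" "z \<noteq> a" "z \<noteq> b"
      using that R by (auto simp: label_def split: if_splits)
    then show "sgn (int (p (Suc z)) - int (p z)) = letter_sign t (label a b x)"
      using R z that by auto
  qed
  have "sgn (int y - int x) = letter_sign t (label a b x) * sgn (int (p y) - int (p x))"
    if xy: "x \<in> {1..n}" "y \<in> {1..n}" "label a b x = label a b y" for x y
  proof (cases x y rule: linorder_cases)
    case less
    then show ?thesis using adj[of x y] xy by simp
  next
    case greater
    then have "sgn (int (p x) - int (p y)) = letter_sign t (label a b x)"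
      using adj[of y x] xy by simp
    then show ?thesis using greater by (simp add: sgn_diff_swap[of "int (p y)"])
  qed simp
  with R show ?L by (simp add: segmentations_def)
qed

text \<open>An increasing permutation fixes 1 and a decreasing one exchanges 1 and \<open>n\<close>;
  in neither case does the orbit of 1 reach 2.\<close>

lemma cyclic_not_monotone:
  assumes cyc: "cyclic_perm n p" and n: "3 \<le> n" and c: "c = 1 \<or> c = -1"
  shows "\<exists>x. 1 \<le> x \<and> x < n \<and> sgn (int (p (Suc x)) - int (p x)) \<noteq> c"
proof (rule ccontr)
  assume no: "\<nexists>x. 1 \<le> x \<and> x < n \<and> sgn (int (p (Suc x)) - int (p x)) \<noteq> c"
  have mono: "sgn (int (p y) - int (p x)) = c" if "1 \<le> x" "x < y" "y \<le> n" for x y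
    by (rule sgn_monotone_chain[OF that(2) c]) (use no that in auto)
  have bij: "bij_betw p {1..n} {1..n}"
    using cyc by (simp add: cyclic_perm_def perm_of_def)
  then have surj: "\<exists>x\<in>{1..n}. p x = y" if "y \<in> {1..n}" for y
    using that by (metis bij_betw_imp_surj_on image_iff)
  have range: "p x \<in> {1..n}" if "x \<in> {1..n}" for x using bij that by (auto dest: bij_betwE)
  have orbit: "\<exists>k. (p ^^ k) 1 = 2" using cyc n by (auto simp: cyclic_perm_def)
  show False
  proof (cases "c = 1")
    case True
    obtain x where x: "x \<in> {1..n}" "p x = 1" using surj[of 1] n by auto
    have "p 1 = 1"
    proof (cases "x = 1")
      case False
      then have "p 1 < p x" using mono[of 1 x] x True by (auto simp: sgn_if split: if_splits)
      then show ?thesis using x range[of 1] n by simp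
    qed (use x in simp)
    then have "(p ^^ k) 1 = 1" for k by (induction k) auto
    then show False using orbit by auto
  next
    case False
    then have c: "c = -1" using c by simp
    obtain x where x: "x \<in> {1..n}" "p x = n" using surj[of n] n by auto
    have p1: "p 1 = n"
    proof (cases "x = 1")
      case False
      then have "p x < p 1" using mono[of 1 x] x c by (auto simp: sgn_if split: if_splits)
      then show ?thesis using x range[of 1] n by simp
    qed (use x in simp)
    obtain y where y: "y \<in> {1..n}" "p y = 1" using surj[of 1] n by auto
    have pn: "p n = 1"
    proof (cases "y = n")
      case False
      then have "p n < p y" using mono[of y n] y c by (auto simp: sgn_if split: if_splits)
      then show ?thesis using y range[of n] n by simp
    qed (use y in simp)
    have "(p ^^ k) 1 = 1 \<or> (p ^^ k) 1 = n" for k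
      by (induction k) (use p1 pn in auto)
    moreover obtain k where "(p ^^ k) 1 = 2" using orbit by blast
    ultimately have "2 = (1::nat) \<or> 2 = n" by metis
    then show False using n by simp
  qed
qed

lemma card_segmentations:
  assumes cyc: "cyclic_perm n p" and n: "3 \<le> n" and ne: "segmentations t n p \<noteq> {}"
  shows "card (segmentations t n p) = 4"
proof -
  have p: "perm_of n p" using cyc by (simp add: cyclic_perm_def)
  let ?c = "letter_sign t 0"
  have ls: "letter_sign t (label a b x) = (if a < x \<and> x \<le> b then - ?c else ?c)" if "a \<le> b" for a b x
    using that by (auto simp: label_def letter_sign_def)
  \<comment> \<open>The steps whose direction is that of the middle segment.\<close>
  define D where "D x \<longleftrightarrow> 1 \<le> x \<and> x < n \<and> sgn (int (p (Suc x)) - int (p x)) = - ?c" for x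
  have sgn_D: "sgn (int (p (Suc x)) - int (p x)) = (if D x then - ?c else ?c)" if "1 \<le> x" "x < n" for x
  proof -
    have "p (Suc x) \<noteq> p x"
      using p that inj_onD[of p "{1..n}" "Suc x" x] by (auto simp: perm_of_def bij_betw_def)
    then show ?thesis using that letter_sign_cases[of t 0] by (auto simp: D_def sgn_if)
  qed
  have seg: "(a, b) \<in> segmentations t n p \<longleftrightarrow> a \<le> b \<and> b \<le> n \<and>
    (\<forall>x. 1 \<le> x \<and> x < n \<and> x \<noteq> a \<and> x \<noteq> b \<longrightarrow> (D x \<longleftrightarrow> a < x \<and> x < b))" for a b
    unfolding segmentations_iff_adjacent[OF p]
    using letter_sign_cases[of t 0] by (intro conj_cong refl all_cong) (auto simp: sgn_D ls)
  obtain a b where ab: "(a, b) \<in> segmentations t n p" using ne by auto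
  obtain x0 where x0: "D x0"
    using cyclic_not_monotone[OF cyc n letter_sign_cases[of t 0]] sgn_D by (auto split: if_splits)
  have Dn: "1 \<le> x" "x < n" if "D x" for x using that by (auto simp: D_def)
  have fin: "finite {x. D x}" by (rule finite_subset[of _ "{..n}"]) (auto simp: D_def)
  define P where "P = Min {x. D x}"
  define M where "M = Max {x. D x}"
  have PM: "D P" "D M" using Min_in[OF fin] Max_in[OF fin] x0 by (auto simp: P_def M_def)
  have bounds: "P \<le> x" "x \<le> M" if "D x" for x using fin that by (auto simp: P_def M_def)
  have D_iff: "D x \<longleftrightarrow> P \<le> x \<and> x \<le> M" for x
  proof
    assume x: "P \<le> x \<and> x \<le> M"
    show "D x"
    proof (cases "x = P \<or> x = M")
      case False
      then have "P < x" "x < M" using x by auto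
      \<comment> \<open>Members of \<open>D\<close> lie between \<open>a\<close> and
        \<open>b\<close> inclusive, and all steps strictly between belong to \<open>D\<close>; hence
        \<open>D\<close> has no gaps.\<close>
      have "a \<le> P" "M \<le> b" using ab PM Dn[OF PM(1)] Dn[OF PM(2)] unfolding seg
        by (metis linorder_not_le order.strict_trans2 less_le_not_le)+
      then show ?thesis using ab \<open>P < x\<close> \<open>x < M\<close> Dn[OF PM(1)] Dn[OF PM(2)] unfolding seg by auto
    qed (use PM in auto)
  qed (use bounds in auto)
  have PM': "1 \<le> P" "P \<le> M" "M < n" using Dn PM D_iff by auto
  \<comment> \<open>Steps at the cuts are unconstrained, so the first cut may come just before or at
    \<open>P\<close> and the second at or just after \<open>M\<close>. The bounds
    \<open>1 \<le> P\<close> and \<open>M < n\<close> keep the four pairs distinct and in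
    range.\<close>
  have "segmentations t n p = {P - 1, P} \<times> {M, M + 1}"
  proof (intro set_eqI iffI; clarify)
    fix a b assume "(a, b) \<in> segmentations t n p"
    then have ab: "a \<le> b" "b \<le> n"
      and S: "\<And>x. 1 \<le> x \<Longrightarrow> x < n \<Longrightarrow> x \<noteq> a \<Longrightarrow> x \<noteq> b \<Longrightarrow> (P \<le> x \<and> x \<le> M) \<longleftrightarrow> (a < x \<and> x < b)"
      unfolding seg D_iff by auto
    have "a \<le> P" "P \<le> b" "a \<le> M" "M \<le> b" using S[of P] S[of M] PM' ab by linarith+
    moreover have "P - 1 \<le> a" using S[of "P - 1"] PM' calculation by linarith
    moreover have "b \<le> M + 1" using S[of "M + 1"] PM' calculation ab by linarith
    ultimately show "a \<in> {P - 1, P} \<and> b \<in> {M, M + 1}" by auto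
  next
    fix a b assume "a \<in> {P - 1, P}" "b \<in> {M, M + 1}"
    then show "(a, b) \<in> segmentations t n p" unfolding seg D_iff using PM' by auto
  qed
  then show ?thesis using PM'(1) by (simp add: card_cartesian_product)
qed

subsection \<open>Coding of cyclic permutations by words\<close>

text \<open>Let \<open>m\<close> be the first return time to \<open>i\<close>. The first
  \<open>m\<close> iterates are distinct and by cyclicity exhaust \<open>{1..n}\<close>, so
  \<open>m = n\<close>.\<close>

lemma cyclic_perm_orbit:
  assumes cyc: "cyclic_perm n p" and i: "i \<in> {1..n}"
  shows "bij_betw (\<lambda>j. (p ^^ j) i) {..<n} {1..n}" and "(p ^^ (j + n)) i = (p ^^ j) i"
    and "(p ^^ j) i \<in> {1..n}"
proof -
  have bij: "bij_betw p {1..n} {1..n}" using cyc by (simp add: cyclic_perm_def perm_of_def)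
  have mem: "(p ^^ j) i \<in> {1..n}" for j
  proof (induction j)
    case (Suc j)
    then show ?case using bij_betwE[OF bij] by simp
  qed (use i in simp)
  obtain k where "(p ^^ k) (p i) = i"
    using cyc i mem[of 1] unfolding cyclic_perm_def by fastforce
  then have ex: "0 < Suc k \<and> (p ^^ Suc k) i = i" by (simp add: funpow_swap1)
  define m where "m = (LEAST m. 0 < m \<and> (p ^^ m) i = i)"
  have m: "0 < m" "(p ^^ m) i = i"
    using LeastI[of "\<lambda>m. 0 < m \<and> (p ^^ m) i = i", OF ex] by (auto simp: m_def)
  have least: "\<not> (0 < r \<and> (p ^^ r) i = i)" if "r < m" for r
    using that unfolding m_def by (rule not_less_Least)
  have ne: "(p ^^ j) i \<noteq> (p ^^ k) i" if "j < k" "k < m" for j k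
  proof
    assume "(p ^^ j) i = (p ^^ k) i"
    \<comment> \<open>Applying \<open>m - k\<close> further steps turns a repetition into a return
      to \<open>i\<close> before time \<open>m\<close>.\<close>
    then have "(p ^^ (m - k + j)) i = (p ^^ (m - k + k)) i" by (simp only: funpow_add o_apply)
    then have "(p ^^ (m - k + j)) i = i" using m that by simp
    moreover have "0 < m - k + j" "m - k + j < m" using that by auto
    ultimately show False using least by blast
  qed
  then have inj: "inj_on (\<lambda>j. (p ^^ j) i) {..<m}"
    by (intro inj_onI) (metis lessThan_iff linorder_neqE_nat)
  have img: "(\<lambda>j. (p ^^ j) i) ` {..<m} = {1..n}"
  proof
    show "{1..n} \<subseteq> (\<lambda>j. (p ^^ j) i) ` {..<m}"
    proof
      fix x assume "x \<in> {1..n}"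
      then obtain k where "(p ^^ k) i = x" using cyc i unfolding cyclic_perm_def by blast
      then have "(p ^^ (k mod m)) i = x" using funpow_mod_eq[OF m(2), of k] by simp
      moreover have "k mod m \<in> {..<m}" using m by simp
      ultimately show "x \<in> (\<lambda>j. (p ^^ j) i) ` {..<m}" by blast
    qed
  qed (use mem in blast)
  have "m = n" using card_image[OF inj] img by simp
  then show "bij_betw (\<lambda>j. (p ^^ j) i) {..<n} {1..n}"
    using inj img unfolding bij_betw_def by blast
  show "(p ^^ (j + n)) i = (p ^^ j) i"
    using m(2) \<open>m = n\<close> by (simp add: funpow_add)
  show "(p ^^ j) i \<in> {1..n}" by (rule mem)
qed

lemma initial_segment_eq:
  fixes A :: "nat set"
  assumes "A \<subseteq> {1..n}" "\<And>x y. x \<in> A \<Longrightarrow> 1 \<le> y \<Longrightarrow> y \<le> x \<Longrightarrow> y \<in> A"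
  shows "A = {1..card A}"
proof (cases "A = {}")
  case False
  have fin: "finite A" using assms(1) finite_subset by blast
  have eq: "A = {1..Max A}"
  proof
    show "A \<subseteq> {1..Max A}" using assms(1) Max_ge[OF fin] by auto
    show "{1..Max A} \<subseteq> A" using assms(2)[OF Max_in[OF fin False]] by auto
  qed
  have "card A = card {1..Max A}" using eq by (rule arg_cong)
  then have "Max A = card A" by simp
  with eq show ?thesis by simp
qed simp

text \<open>A permutation with base point and segmentation is sent to the itinerary of the base
  point together with its trajectory, the latter being an order compatible with the former.\<close>

definition coding :: "(nat \<Rightarrow> nat) \<times> nat \<times> nat \<times> nat \<Rightarrow> (nat \<Rightarrow> nat) \<times> (nat \<Rightarrow> nat)" where
  "coding = (\<lambda>(p, i, a, b). (\<lambda>j. label a b ((p ^^ j) i), \<lambda>j. (p ^^ j) i))"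

lemma label_eq_imp_eq:
  assumes "a \<le> b" "b \<le> n" "a' \<le> b'" "b' \<le> n"
    and eq: "\<And>x. x \<in> {1..n} \<Longrightarrow> label a b x = label a' b' x"
  shows "a = a' \<and> b = b'"
proof -
  have le: "x \<le> a \<longleftrightarrow> x \<le> a'" "x \<le> b \<longleftrightarrow> x \<le> b'" if "1 \<le> x" "x \<le> n" for x
  proof -
    have "label a b x = label a' b' x" using eq that by simp
    then show "x \<le> a \<longleftrightarrow> x \<le> a'" "x \<le> b \<longleftrightarrow> x \<le> b'"
      using assms(1-4) by (auto simp: label_def split: if_splits)
  qed
  have "a = a'" using le(1)[of a] le(1)[of a'] assms by (cases "a = 0"; cases "a' = 0") auto
  moreover have "b = b'" using le(2)[of b] le(2)[of b'] assms by (cases "b = 0"; cases "b' = 0") auto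
  ultimately show ?thesis by simp
qed

text \<open>The trajectory starts at the base point and visits every point, so its consecutive
  values determine \<open>p\<close> and the letters along it determine the labels, hence the
  cuts.\<close>

lemma coding_inj:
  "inj_on coding (SIGMA p:cyc_class [t, \<not> t, t] n. {1..n} \<times> segmentations t n p)"
proof (rule inj_onI, clarsimp simp del: One_nat_def)
  fix p i a b p' i' a' b'
  assume p: "p \<in> cyc_class [t, \<not> t, t] n" "p' \<in> cyc_class [t, \<not> t, t] n"
    and i: "1 \<le> i" "i \<le> n" "1 \<le> i'" "i' \<le> n"
    and s: "(a, b) \<in> segmentations t n p" "(a', b') \<in> segmentations t n p'"
    and "coding (p, i, a, b) = coding (p', i', a', b')"
  then have f: "\<And>j. (p ^^ j) i = (p' ^^ j) i'"
    and w: "\<And>j. label a b ((p ^^ j) i) = label a' b' ((p' ^^ j) i')"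
    unfolding coding_def by (auto dest: fun_cong)
  have cyc: "cyclic_perm n p" "cyclic_perm n p'" using p by (simp_all add: cyc_class_def)
  have ex: "\<exists>j. x = (p ^^ j) i" if "x \<in> {1..n}" for x
    using cyclic_perm_orbit(1)[OF cyc(1), of i] i that by (auto simp: bij_betw_def image_iff set_eq_iff)
  have "p x = p' x" for x
  proof (cases "x \<in> {1..n}")
    case True
    then obtain j where "x = (p ^^ j) i" using ex by blast
    then show ?thesis using f[of j] f[of "Suc j"] by simp
  next
    case False
    then show ?thesis using cyc by (simp add: cyclic_perm_def perm_of_def)
  qed
  moreover have "i = i'" using f[of 0] by simp
  moreover have "a = a' \<and> b = b'"
  proof (rule label_eq_imp_eq)
    show "label a b x = label a' b' x" if "x \<in> {1..n}" for x
      using ex[OF that] w f by auto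
  qed (use s in \<open>auto simp: segmentations_def\<close>)
  ultimately show "p = p' \<and> i = i' \<and> a = a' \<and> b = b'" by auto
qed

lemma coding_in_orders:
  assumes p: "p \<in> cyc_class [t, \<not> t, t] n" and i: "i \<in> {1..n}" and s: "(a, b) \<in> segmentations t n p"
  shows "coding (p, i, a, b) \<in> (SIGMA w:words n. orders t n w)"
proof -
  have cyc: "cyclic_perm n p" using p by (simp add: cyc_class_def)
  note orbit = cyclic_perm_orbit[OF cyc i]
  have ab: "a \<le> b" using s by (simp add: segmentations_def)
  have "(\<lambda>j. label a b ((p ^^ j) i)) \<in> words n"
    using orbit(2) by (simp add: words_def label_def)
  moreover have "(\<lambda>j. (p ^^ j) i) \<in> orders t n (\<lambda>j. label a b ((p ^^ j) i))"
    unfolding orders_def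
  proof (intro CollectI conjI allI impI)
    show "(p ^^ j) i < (p ^^ k) i" if "label a b ((p ^^ j) i) < label a b ((p ^^ k) i)" for j k
      using that ab by (auto simp: label_def split: if_splits)
    show "sgn (int ((p ^^ k) i) - int ((p ^^ j) i)) = letter_sign t (label a b ((p ^^ j) i))
        * sgn (int ((p ^^ Suc k) i) - int ((p ^^ Suc j) i))"
      if "label a b ((p ^^ j) i) = label a b ((p ^^ k) i)" for j k
    proof -
      have "\<forall>x\<in>{1..n}. \<forall>y\<in>{1..n}. label a b x = label a b y \<longrightarrow>
        sgn (int y - int x) = letter_sign t (label a b x) * sgn (int (p y) - int (p x))"
        using s unfolding segmentations_def by blast
      from this[rule_format, OF orbit(3) orbit(3) that] show ?thesis by simp
    qed
  qed (use orbit in auto)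
  ultimately show ?thesis by (simp add: coding_def)
qed

text \<open>The permutation sends each \<open>f j\<close> to \<open>f (Suc j)\<close>. As smaller
  letters sit at smaller points, the letters split \<open>{1..n}\<close> into consecutive intervals,
  which provide the segmentation.\<close>

lemma coding_surj:
  assumes w: "w \<in> words n" and f: "f \<in> orders t n w" and n: "0 < n"
  shows "(w, f) \<in> coding ` (SIGMA p:cyc_class [t, \<not> t, t] n. {1..n} \<times> segmentations t n p)"
proof -
  have bij: "bij_betw f {..<n} {1..n}" using f by (simp add: orders_def)
  define g where "g = inv_into {..<n} f"
  have fg: "f (g x) = x" if "x \<in> {1..n}" for x
    using bij that unfolding g_def by (metis bij_betw_inv_into_right)
  have mem: "f j \<in> {1..n}" for j
    using bij_betwE[OF bij] orders_mod[OF f, of j] n by (metis lessThan_iff mod_less_divisor)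
  have gf: "g (f j) = j mod n" for j
    using bij_betw_inv_into_left[OF bij, of "j mod n"] orders_mod[OF f, of j] n by (simp add: g_def)
  define p where "p x = (if x \<in> {1..n} then f (Suc (g x)) else x)" for x
  have pf: "p (f j) = f (Suc j)" for j
  proof -
    have "p (f j) = f (Suc (j mod n))" using mem by (simp add: p_def gf)
    also have "\<dots> = f (Suc j)" using orders_mod[OF f] by (metis mod_Suc_eq)
    finally show ?thesis .
  qed
  have pow: "(p ^^ r) (f j) = f (j + r)" for r j by (induction r) (auto simp: pf)
  have img: "p ` {1..n} = {1..n}"
  proof
    show "p ` {1..n} \<subseteq> {1..n}" using mem unfolding p_def by auto
    show "{1..n} \<subseteq> p ` {1..n}"
    proof
      fix y assume y: "y \<in> {1..n}"
      \<comment> \<open>The predecessor of \<open>y\<close> on the cycle; adding \<open>n\<close>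
        avoids truncation when \<open>g y = 0\<close>.\<close>
      have "p (f (g y + n - 1)) = y"
        using n fg[OF y] orders_periodic[OF f, of "g y"] by (simp add: pf)
      then show "y \<in> p ` {1..n}" using mem by (metis image_eqI)
    qed
  qed
  then have "inj_on p {1..n}" by (intro finite_surj_inj) auto
  then have perm: "perm_of n p" using img by (auto simp: perm_of_def bij_betw_def p_def)
  have cyc: "cyclic_perm n p"
    unfolding cyclic_perm_def
  proof (intro conjI ballI perm)
    fix x y assume xy: "x \<in> {1..n}" "y \<in> {1..n}"
    have "g x < n" using bij xy(1) unfolding g_def
      by (metis bij_betw_def inv_into_into lessThan_iff)
    \<comment> \<open>The number of steps from \<open>x\<close> to \<open>y\<close>, increased by
      \<open>n\<close> so that the subtraction is exact.\<close>
    then have "f (g x + (g y + n - g x)) = f (g y)"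
      using orders_periodic[OF f, of "g y"] by simp
    then have "(p ^^ (g y + n - g x)) x = y"
      using pow[of "g y + n - g x" "g x"] fg xy by simp
    then show "\<exists>k. (p ^^ k) x = y" by blast
  qed
  \<comment> \<open>The points with letter below 1, and those with letter below 2, form initial
    segments, so their numbers are the cuts.\<close>
  define a where "a = card {x \<in> {1..n}. w (g x) < 1}"
  define b where "b = card {x \<in> {1..n}. w (g x) < 2}"
  have seg: "{x \<in> {1..n}. w (g x) < c} = {1..card {x \<in> {1..n}. w (g x) < c}}" for c
  proof (rule initial_segment_eq)
    show "y \<in> {x \<in> {1..n}. w (g x) < c}" if "x \<in> {x \<in> {1..n}. w (g x) < c}" "1 \<le> y" "y \<le> x" for x y
    proof -
      have "\<not> w (g x) < w (g y)" using orders_letter_less[OF f, of "g x" "g y"] fg that by auto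
      then show ?thesis using that by auto
    qed
  qed auto
  have "a \<le> b" unfolding a_def b_def by (rule card_mono) auto
  moreover have "b \<le> card {1..n}" unfolding b_def by (rule card_mono) auto
  ultimately have ab: "a \<le> b" "b \<le> n" by simp_all
  have lab: "label a b x = w (g x)" if x: "x \<in> {1..n}" for x
  proof -
    have "x \<le> a \<longleftrightarrow> w (g x) < 1" "x \<le> b \<longleftrightarrow> w (g x) < 2"
      using seg[of 1] seg[of 2] x unfolding a_def[symmetric] b_def[symmetric] by (auto simp: set_eq_iff)
    moreover have "w (g x) < 3" using w by (simp add: words_def)
    ultimately show ?thesis by (auto simp: label_def)
  qed
  have s: "(a, b) \<in> segmentations t n p"
    unfolding segmentations_def
  proof (intro CollectI, unfold prod.case, intro conjI ballI impI ab)
    fix x y assume xy: "x \<in> {1..n}" "y \<in> {1..n}" "label a b x = label a b y"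
    then have "w (g x) = w (g y)" using lab by simp
    then have "sgn (int (f (g y)) - int (f (g x)))
        = letter_sign t (w (g x)) * sgn (int (f (Suc (g y))) - int (f (Suc (g x))))"
      using f unfolding orders_def by blast
    then show "sgn (int y - int x) = letter_sign t (label a b x) * sgn (int (p y) - int (p x))"
      using xy fg lab by (simp add: p_def)
  qed
  have "p \<in> cyc_class [t, \<not> t, t] n"
    using cyc perm s by (auto simp: cyc_class_def in_sig_class_iff)
  moreover have "coding (p, f 0, a, b) = (w, f)"
  proof -
    have "label a b (f j) = w j" for j using lab[OF mem] gf words_mod[OF w] by simp
    then show ?thesis by (simp add: coding_def pow)
  qed
  ultimately show ?thesis using s mem[of 0] by (intro image_eqI[of _ _ "(p, f 0, a, b)"]) auto
qed

section \<open>Double counting and conclusion\<close>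

lemma finite_orders:
  assumes "w \<in> words n" "0 < n"
  shows "finite (orders t n w)"
proof (cases "orders t n w = {}")
  case False
  \<comment> \<open>A nonempty set of orders has cardinality 1 or 2 by the counts above, and
    infinite sets have \<open>card\<close> 0.\<close>
  then have "card (orders t n w) > 0"
    using orders_empty[OF assms] card_orders_primitive[of w n t] card_orders_square[of w _ t] assms
    by fastforce
  then show ?thesis by (rule card_ge_0_finite)
qed simp

text \<open>Each permutation in the class has \<open>n\<close> base points and four segmentations,
  and \<open>coding\<close> matches these triples with the pairs of a word and a compatible
  order.\<close>

lemma card_cyc_class:
  assumes n: "3 \<le> n"
  shows "4 * n * card (cyc_class [t, \<not> t, t] n) = (\<Sum>w\<in>words n. card (orders t n w))"
proof -
  let ?A = "SIGMA p:cyc_class [t, \<not> t, t] n. {1..n} \<times> segmentations t n p"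
  let ?B = "SIGMA w:words n. orders t n w"
  have "coding ` ?A \<subseteq> ?B"
  proof (rule image_subsetI)
    fix x assume "x \<in> ?A"
    moreover obtain p i a b where "x = (p, i, a, b)" by (cases x) auto
    ultimately show "coding x \<in> ?B" using coding_in_orders[of p t n i a b] by simp
  qed
  moreover have "?B \<subseteq> coding ` ?A" using coding_surj n by auto
  ultimately have bij: "bij_betw coding ?A ?B" using coding_inj by (auto simp: bij_betw_def)
  have finB: "finite ?B" using n finite_words finite_orders by auto
  then have finA: "finite ?A" using bij_betw_finite[OF bij] by simp
  have seg4: "card (segmentations t n p) = 4" if "p \<in> cyc_class [t, \<not> t, t] n" for p
    using that n by (intro card_segmentations) (auto simp: cyc_class_def in_sig_class_iff)
  have fin_seg: "finite (segmentations t n p)" if "p \<in> cyc_class [t, \<not> t, t] n" for p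
    using seg4[OF that] by (intro card_ge_0_finite) simp
  \<comment> \<open>The class is covered by a projection of the finite set of triples, so it is
    finite.\<close>
  have "cyc_class [t, \<not> t, t] n \<subseteq> fst ` ?A"
  proof
    fix p assume p: "p \<in> cyc_class [t, \<not> t, t] n"
    then obtain s where "s \<in> segmentations t n p" by (auto simp: cyc_class_def in_sig_class_iff)
    then have "(p, 1, s) \<in> ?A" using p n by auto
    then show "p \<in> fst ` ?A" by force
  qed
  then have fin: "finite (cyc_class [t, \<not> t, t] n)" using finA finite_surj by blast
  have "(\<Sum>w\<in>words n. card (orders t n w)) = card ?B"
    using n finite_words finite_orders by simp
  also have "\<dots> = card ?A" using bij_betw_same_card[OF bij] by simp
  also have "\<dots> = (\<Sum>p\<in>cyc_class [t, \<not> t, t] n. card ({1..n} \<times> segmentations t n p))"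
    using fin fin_seg by (intro card_SigmaI) auto
  also have "\<dots> = 4 * n * card (cyc_class [t, \<not> t, t] n)"
    using seg4 by (simp add: card_cartesian_product)
  finally show ?thesis by simp
qed

theorem theorem5p1:
  fixes n :: nat
  assumes "n \<ge> 3"
  shows "card (cyc_class [True, False, True] n) = card (cyc_class [False, True, False] n)"
proof -
  have "4 * n * card (cyc_class [True, False, True] n)
      = 4 * n * card (cyc_class [False, True, False] n)"
    using card_cyc_class[OF assms, of True] card_cyc_class[OF assms, of False]
      sum_card_orders_eq[OF assms] by simp
  then show ?thesis using assms by simp
qed

end
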